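(* Let $A(N)$ denote the number of generalised Petersen graphs $P(n,k)$, up to isomorphism, that have $n \leq N$, and let $B(N)$ denote the number of those (up to isomorphism) that are also Cayley graphs. Then $$\lim_{N \rightarrow \infty} \frac{B(N)}{A(N)} = 0.$$
   Context: For positive integers $n \geq 3$ and $k \leq n/2$, the generalised Petersen graph $P(n,k)$ is the graph with vertex set $\{a_i, b_i : 0 \leq i \leq n-1\}$ (so $2n$ vertices) and edges $a_i a_{i+1}$, $a_i b_i$, $b_i b_{i+k}$ for $0 \leq i \leq n-1$, with subscripts read modulo $n$. When $k=n/2$, the edges $b_ib_{i+k}$ and $b_{i+k}b_{i+2k}=b_{i+k}b_i$ are counted separately, so that $b_i$ and $b_{i+k}$ are joined by a double edge. With this convention $P(n,k)$ is always connected and cubic ($3$-regular). A graph is a Cayley graph if it is isomorphic to the (simple, undirected) graph $X(G,S)$ with vertex set a group $G$ and edges $\{g,gs\}$ for $g \in G$, $s \in S$, for some group $G$ and some symmetric subset $S=S^{-1}$ of $G$ with $1 \notin S$. *)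

theory Defs
  imports Complex_Main "HOL-Algebra.Group"
begin

text \<open>Undirected multigraphs are given by incidence: each edge has a set of end vertices, and
  distinct edges may have the same ends.\<close>

record ('v, 'e) multigraph =
  verts :: "'v set"
  edges :: "'e set"
  ends :: "'e \<Rightarrow> 'v set"

definition multigraph_iso :: "('v, 'e) multigraph \<Rightarrow> ('w, 'd) multigraph \<Rightarrow> bool" where
  "multigraph_iso X Y \<longleftrightarrow>
     (\<exists>f \<phi>. bij_betw f (verts X) (verts Y) \<and> bij_betw \<phi> (edges X) (edges Y) \<and>
        (\<forall>e\<in>edges X. ends Y (\<phi> e) = f ` ends X e))"

datatype gp_vertex = A_vertex nat | B_vertex nat

datatype gp_edge = Outer nat | Spoke nat | Inner nat

fun gp_ends :: "nat \<Rightarrow> nat \<Rightarrow> gp_edge \<Rightarrow> gp_vertex set" where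
  "gp_ends n k (Outer i) = {A_vertex i, A_vertex ((i + 1) mod n)}"
| "gp_ends n k (Spoke i) = {A_vertex i, B_vertex i}"
| "gp_ends n k (Inner i) = {B_vertex i, B_vertex ((i + k) mod n)}"

text \<open>The inner edges are indexed by \<open>i < n\<close>, so for \<open>2 * k = n\<close> the edges \<open>Inner i\<close> and
  \<open>Inner (i + k)\<close> are distinct and form a double edge.\<close>

definition gen_petersen :: "nat \<Rightarrow> nat \<Rightarrow> (gp_vertex, gp_edge) multigraph" where
  "gen_petersen n k =
     \<lparr>verts = A_vertex ` {0..<n} \<union> B_vertex ` {0..<n},
      edges = Outer ` {0..<n} \<union> Spoke ` {0..<n} \<union> Inner ` {0..<n},
      ends = gp_ends n k\<rparr>"

definition cayley_graph :: "('g, 'm) monoid_scheme \<Rightarrow> 'g set \<Rightarrow> ('g, 'g set) multigraph" where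
  "cayley_graph G S =
     \<lparr>verts = carrier G,
      edges = {{g, g \<otimes>\<^bsub>G\<^esub> s} | g s. g \<in> carrier G \<and> s \<in> S},
      ends = (\<lambda>e. e)\<rparr>"

definition connection_set :: "('g, 'm) monoid_scheme \<Rightarrow> 'g set \<Rightarrow> bool" where
  "connection_set G S \<longleftrightarrow>
     S \<subseteq> carrier G \<and> (\<lambda>s. inv\<^bsub>G\<^esub> s) ` S = S \<and> \<one>\<^bsub>G\<^esub> \<notin> S"

text \<open>The group is taken over the vertex type of \<open>X\<close>. This is no restriction: by
  \<open>is_cayley_graphI\<close> below, an isomorphism with a Cayley graph of a group over any type suffices.\<close>

definition is_cayley_graph :: "('v, 'e) multigraph \<Rightarrow> bool" where
  "is_cayley_graph X \<longleftrightarrow>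
     (\<exists>(G :: 'v monoid) S. group G \<and> connection_set G S \<and> multigraph_iso X (cayley_graph G S))"

definition num_iso_classes :: "('v, 'e) multigraph set \<Rightarrow> nat" where
  "num_iso_classes \<X> = card (\<X> // {(X, Y). X \<in> \<X> \<and> Y \<in> \<X> \<and> multigraph_iso X Y})"

definition gen_petersen_upto :: "nat \<Rightarrow> (gp_vertex, gp_edge) multigraph set" where
  "gen_petersen_upto N = {gen_petersen n k | n k. 3 \<le> n \<and> n \<le> N \<and> 1 \<le> k \<and> 2 * k \<le> n}"

definition num_gen_petersen :: "nat \<Rightarrow> nat" where
  "num_gen_petersen N = num_iso_classes (gen_petersen_upto N)"

definition num_cayley_gen_petersen :: "nat \<Rightarrow> nat" where
  "num_cayley_gen_petersen N = num_iso_classes {X \<in> gen_petersen_upto N. is_cayley_graph X}"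

lemma multigraph_iso_refl: "multigraph_iso X X"
  unfolding multigraph_iso_def
  by (rule exI[of _ id], rule exI[of _ id]) auto

lemma multigraph_iso_trans:
  assumes "multigraph_iso X Y" "multigraph_iso Y Z"
  shows "multigraph_iso X Z"
proof -
  obtain f p where fp: "bij_betw f (verts X) (verts Y)" "bij_betw p (edges X) (edges Y)"
    "\<forall>e\<in>edges X. ends Y (p e) = f ` ends X e"
    using assms(1) unfolding multigraph_iso_def by blast
  obtain g q where gq: "bij_betw g (verts Y) (verts Z)" "bij_betw q (edges Y) (edges Z)"
    "\<forall>e\<in>edges Y. ends Z (q e) = g ` ends Y e"
    using assms(2) unfolding multigraph_iso_def by blast
  have "bij_betw (g \<circ> f) (verts X) (verts Z)" "bij_betw (q \<circ> p) (edges X) (edges Z)"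
    using fp gq by (auto intro: bij_betw_trans)
  moreover have "\<forall>e\<in>edges X. ends Z ((q \<circ> p) e) = (g \<circ> f) ` ends X e"
    using fp gq by (auto simp: image_comp dest: bij_betwE)
  ultimately show ?thesis unfolding multigraph_iso_def by blast
qed

lemma multigraph_iso_sym:
  assumes wf: "\<And>e. e \<in> edges X \<Longrightarrow> ends X e \<subseteq> verts X" and "multigraph_iso X Y"
  shows "multigraph_iso Y X"
proof -
  obtain f p where fp: "bij_betw f (verts X) (verts Y)" "bij_betw p (edges X) (edges Y)"
    "\<forall>e\<in>edges X. ends Y (p e) = f ` ends X e"
    using assms(2) unfolding multigraph_iso_def by blast
  let ?g = "inv_into (verts X) f" and ?q = "inv_into (edges X) p"
  have "ends X (?q d) = ?g ` ends Y d" if d: "d \<in> edges Y" for d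
  proof -
    have e: "?q d \<in> edges X" "p (?q d) = d"
      using d fp(2) by (auto simp: bij_betw_def inv_into_into f_inv_into_f)
    have "?g ` ends Y d = ?g ` f ` ends X (?q d)" using fp(3) e by metis
    also have "\<dots> = ends X (?q d)"
      using wf[OF e(1)] fp(1) by (simp add: bij_betw_def inv_into_image_cancel)
    finally show ?thesis by simp
  qed
  moreover have "bij_betw ?g (verts Y) (verts X)" "bij_betw ?q (edges Y) (edges X)"
    using fp by (auto intro: bij_betw_inv_into)
  ultimately show ?thesis unfolding multigraph_iso_def by blast
qed

lemma gen_petersen_ends:
  assumes "X \<in> gen_petersen_upto N" "e \<in> edges X"
  shows "ends X e \<subseteq> verts X"
  using assms by (auto simp: gen_petersen_upto_def gen_petersen_def)

lemma equiv_gen_petersen_iso: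
  assumes "\<X> \<subseteq> gen_petersen_upto N"
  shows "equiv \<X> {(X, Y). X \<in> \<X> \<and> Y \<in> \<X> \<and> multigraph_iso X Y}"
proof -
  have "multigraph_iso Y X" if "X \<in> \<X>" "multigraph_iso X Y" for X Y
    by (rule multigraph_iso_sym[OF gen_petersen_ends that(2)]) (use that(1) assms in auto)
  then show ?thesis
    by (intro equivI refl_onI symI transI)
      (auto simp: multigraph_iso_refl dest: multigraph_iso_trans)
qed

lemma finite_gen_petersen_upto: "finite (gen_petersen_upto N)"
proof (rule finite_subset)
  show "gen_petersen_upto N \<subseteq> (\<lambda>(n, k). gen_petersen n k) ` ({0..N} \<times> {0..N})"
    by (auto simp: gen_petersen_upto_def image_iff)
qed simp

lemma is_cayley_graphI:
  fixes X :: "('v, 'e) multigraph" and G :: "('g, 'm) monoid_scheme" (structure)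
  assumes G: "group G" and S: "connection_set G S" and iso: "multigraph_iso X (cayley_graph G S)"
  shows "is_cayley_graph X"
proof -
  interpret group G by (rule G)
  obtain f where f: "bij_betw f (verts X) (carrier G)"
    using iso unfolding multigraph_iso_def cayley_graph_def by auto
  define h where "h = inv_into (verts X) f"
  have h: "bij_betw h (carrier G) (verts X)" using f by (simp add: h_def bij_betw_inv_into)
  have fh: "f (h x) = x" if "x \<in> carrier G" for x
    using f that by (auto simp: h_def bij_betw_def f_inv_into_f)
  define H where "H = \<lparr>carrier = verts X, monoid.mult = (\<lambda>x y. h (f x \<otimes> f y)), one = h \<one>\<rparr>"
  have cH: "carrier H = verts X" "carrier H = h ` carrier G"
    using h by (simp_all add: H_def bij_betw_def)
  have hm: "h \<in> hom G H"
    using h fh by (auto simp: hom_def H_def dest: bij_betwE)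
  have hi: "h \<in> Group.iso G H" using hm h by (simp add: Group.iso_def H_def)
  have "group (H\<lparr>one := h \<one>\<rparr>)" by (rule iso_imp_img_group[OF hi])
  then have H: "group H" by (simp add: H_def)
  interpret hh: group_hom G H h
    using G H hm by (simp add: group_hom_def group_hom_axioms_def)
  have inj: "inj_on h (carrier G)" using h by (simp add: bij_betw_def)
  have SG: "S \<subseteq> carrier G" "(\<lambda>s. inv s) ` S = S" "\<one> \<notin> S" using S by (auto simp: connection_set_def)
  have "connection_set H (h ` S)"
    unfolding connection_set_def
  proof (intro conjI)
    show "h ` S \<subseteq> carrier H" using SG(1) by auto
    have "(\<lambda>s. inv\<^bsub>H\<^esub> s) ` h ` S = h ` (\<lambda>s. inv s) ` S"
      unfolding image_image by (rule image_cong) (use SG(1) in auto)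
    then show "(\<lambda>s. inv\<^bsub>H\<^esub> s) ` h ` S = h ` S" using SG(2) by simp
    show "\<one>\<^bsub>H\<^esub> \<notin> h ` S"
    proof
      assume "\<one>\<^bsub>H\<^esub> \<in> h ` S"
      then obtain s where s: "s \<in> S" "h s = h \<one>" by force
      then have "s = \<one>" using inj_onD[OF inj s(2) _ one_closed] SG(1) by blast
      then show False using s SG(3) by simp
    qed
  qed
  moreover have "multigraph_iso (cayley_graph G S) (cayley_graph H (h ` S))"
  proof -
    let ?E = "edges (cayley_graph G S)"
    have sub: "?E \<subseteq> Pow (carrier G)" using SG(1) by (auto simp: cayley_graph_def)
    have hE: "h ` {g, g \<otimes> s} = {h g, h g \<otimes>\<^bsub>H\<^esub> h s}" if "g \<in> carrier G" "s \<in> S" for g s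
      using that SG(1) by auto
    have "(`) h ` ?E = edges (cayley_graph H (h ` S))"
    proof (intro equalityI subsetI)
      fix d assume "d \<in> (`) h ` ?E"
      then obtain g s where "g \<in> carrier G" "s \<in> S" "d = h ` {g, g \<otimes> s}"
        by (auto simp: cayley_graph_def)
      then have "d = {h g, h g \<otimes>\<^bsub>H\<^esub> h s}" "h g \<in> carrier H" "h s \<in> h ` S"
        using hE by auto
      then show "d \<in> edges (cayley_graph H (h ` S))"
        unfolding cayley_graph_def multigraph.simps by blast
    next
      fix d assume "d \<in> edges (cayley_graph H (h ` S))"
      then obtain x s where x: "x \<in> carrier H" "s \<in> S" "d = {x, x \<otimes>\<^bsub>H\<^esub> h s}"
        by (auto simp: cayley_graph_def)
      moreover obtain g where "g \<in> carrier G" "x = h g"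
        using x(1) cH(2) by blast
      ultimately have "d = h ` {g, g \<otimes> s}" "{g, g \<otimes> s} \<in> ?E"
        using hE[of g s] unfolding cayley_graph_def multigraph.simps by (simp, blast)
      then show "d \<in> (`) h ` ?E" by blast
    qed
    moreover have "inj_on ((`) h) ?E"
      using inj_on_subset[OF inj_on_image_Pow[OF inj] sub] .
    ultimately have "bij_betw ((`) h) ?E (edges (cayley_graph H (h ` S)))"
      by (simp add: bij_betw_def)
    then show ?thesis
      unfolding multigraph_iso_def
      by (intro exI[of _ h] exI[of _ "(`) h"]) (use h in \<open>simp add: cayley_graph_def cH(1)\<close>)
  qed
  ultimately show ?thesis
    unfolding is_cayley_graph_def using H multigraph_iso_trans[OF iso] by blast
qed

end

theory Submission
  imports Defs "HOL-Real_Asymp.Real_Asymp"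
begin

text \<open>Call \<open>(n, k)\<close> generic if \<open>n\<close> divides no \<open>x + y k\<close> with \<open>(x, y) \<noteq> 0\<close> and both
  \<open>\<bar>x\<bar>, \<bar>y\<bar> \<le> 8\<close>; for each \<open>n\<close> all but boundedly many \<open>k\<close> are generic. In a generic graph a
  non-backtracking closed walk of length 8 never passes two consecutive outer or two consecutive
  inner edges, whereas a spoke followed by any other edge extends to one. Hence an isomorphism of
  generic graphs sends spokes to spokes and the outer rim to a walk along one kind of edge, which
  forces \<open>k \<equiv> \<plusminus>l\<close> or \<open>k l \<equiv> \<plusminus>1\<close> modulo \<open>n\<close>.

  A Cayley graph has an automorphism sending a rim vertex to an inner vertex, so \<open>k\<^sup>2 \<equiv> \<plusminus>1\<close>. For fixed
  \<open>n\<close> and sign, \<open>k \<mapsto> gcd(n, k - k\<^sub>0)\<close> injects the solutions into the divisors of \<open>n\<close>, so there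
  are at most \<open>O(\<surd>n)\<close> of them and the numerator is \<open>O(N\<^sup>3\<^sup>/\<^sup>2)\<close>. The generic graphs with both
  \<open>n\<close> and \<open>k\<close> even are pairwise non-isomorphic, so the denominator grows quadratically.\<close>

section \<open>Vertices and adjacency\<close>

text \<open>Edge multiplicities are dropped: the congruences on \<open>k\<close> and
  \<open>l\<close> are extracted from the vertex map of an isomorphism alone.\<close>

definition adjacent :: "('v, 'e) multigraph \<Rightarrow> 'v \<Rightarrow> 'v \<Rightarrow> bool" where
  "adjacent X u v \<longleftrightarrow> (\<exists>e\<in>edges X. ends X e = {u, v})"

text \<open>Integer indices allow steps in both directions without truncation, and the Boolean
  (\<open>True\<close> for the inner rim) lets one argument serve both rims: \<open>\<not> t\<close>
  crosses a spoke and \<open>stride k t\<close> is one step along rim \<open>t\<close>.\<close>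

definition vert :: "nat \<Rightarrow> bool \<Rightarrow> int \<Rightarrow> gp_vertex" where
  "vert n t i = (if t then B_vertex (nat (i mod int n)) else A_vertex (nat (i mod int n)))"

definition stride :: "nat \<Rightarrow> bool \<Rightarrow> int" where
  "stride k t = (if t then int k else 1)"

lemma nat_mod_eq_iff:
  assumes "n > 0"
  shows "nat (i mod int n) = nat (j mod int n) \<longleftrightarrow> int n dvd i - j"
  using assms by (auto simp: mod_eq_dvd_iff eq_nat_nat_iff)

lemma vert_eq_iff:
  assumes "n > 0"
  shows "vert n t i = vert n s j \<longleftrightarrow> t = s \<and> int n dvd i - j"
  using nat_mod_eq_iff[OF assms] by (auto simp: vert_def)

lemma vert_in_verts: "n > 0 \<Longrightarrow> vert n t i \<in> verts (gen_petersen n k)"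
  by (auto simp: vert_def gen_petersen_def nat_less_iff)

lemma vert_exhaust:
  assumes "v \<in> verts (gen_petersen n k)"
  obtains t i where "v = vert n t i"
proof -
  from assms consider j where "j < n" "v = A_vertex j" | j where "j < n" "v = B_vertex j"
    by (auto simp: gen_petersen_def)
  then show thesis
  proof cases
    case 1 then show thesis using that[of False "int j"] by (simp add: vert_def)
  next
    case 2 then show thesis using that[of True "int j"] by (simp add: vert_def)
  qed
qed

lemma card_verts_gen_petersen: "card (verts (gen_petersen n k)) = 2 * n"
proof -
  have "card (A_vertex ` {0..<n} \<union> B_vertex ` {0..<n})
      = card (A_vertex ` {0..<n}) + card (B_vertex ` {0..<n})"
    by (rule card_Un_disjoint) auto
  then show ?thesis by (simp add: gen_petersen_def card_image inj_on_def)
qed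

lemma adjacent_vert_iff:
  assumes n: "n > 0"
  shows "adjacent (gen_petersen n k) (vert n t i) w \<longleftrightarrow>
    w = vert n t (i + stride k t) \<or> w = vert n t (i - stride k t) \<or> w = vert n (\<not> t) i"
    (is "?L \<longleftrightarrow> ?R")
proof
  have mod_nat: "(j + m) mod n = nat ((int j + int m) mod int n)" for j m
    by (metis nat_int of_nat_add zmod_int)
  have A: "A_vertex j = vert n False (int j)" if "j < n" for j
    using that by (simp add: vert_def)
  have B: "B_vertex j = vert n True (int j)" if "j < n" for j
    using that by (simp add: vert_def)
  have A': "A_vertex ((j + m) mod n) = vert n False (int j + int m)" for j m
    by (simp add: vert_def mod_nat)
  have B': "B_vertex ((j + m) mod n) = vert n True (int j + int m)" for j m
    by (simp add: vert_def mod_nat)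
  {
    assume ?L
    then obtain e where e: "e \<in> edges (gen_petersen n k)"
      "gp_ends n k e = {vert n t i, w}"
      by (auto simp: adjacent_def gen_petersen_def)
    then obtain j where j: "j < n" "e = Outer j \<or> e = Spoke j \<or> e = Inner j"
      by (auto simp: gen_petersen_def)
    have shift: "vert n s i = vert n s' (j + d) \<Longrightarrow> vert n s' j = vert n s (i - d)" for s s' j d
      using n dvd_minus_iff[of "int n" "i - (j + d)"] by (auto simp: vert_eq_iff algebra_simps)
    have shift': "vert n s i = vert n s' j \<Longrightarrow> vert n s' (j + d) = vert n s (i + d)" for s s' j d
      using n dvd_minus_iff[of "int n" "i - j"] by (auto simp: vert_eq_iff algebra_simps)
    have dir: "s = t" if "vert n t i = vert n s j" for s j
      using that n by (simp add: vert_eq_iff)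
    have opp: "vert n (\<not> s) j = vert n (\<not> t) i" if "vert n t i = vert n s j" for s j
      using that n dvd_minus_iff[of "int n" "i - j"] by (auto simp: vert_eq_iff)
    have pair: "({a, b} = {c, d}) = (a = c \<and> b = d \<or> a = d \<and> b = c)" for a b c d :: gp_vertex
      by (auto simp: doubleton_eq_iff)
    from j(2) show ?R
    proof (elim disjE)
      assume "e = Outer j"
      then have eq: "{vert n False (int j), vert n False (int j + 1)} = {vert n t i, w}"
        using e(2) A[OF j(1)] A'[of j 1] by simp
      then have "vert n t i = vert n False (int j) \<and> w = vert n False (int j + 1)
        \<or> vert n t i = vert n False (int j + 1) \<and> w = vert n False (int j)"
        unfolding pair by auto
      then have "w = vert n t (i + 1) \<or> w = vert n t (i - 1)" "\<not> t"
        using dir shift shift' by blast+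
      then show ?R by (auto simp: stride_def)
    next
      assume "e = Inner j"
      then have eq: "{vert n True (int j), vert n True (int j + int k)} = {vert n t i, w}"
        using e(2) B[OF j(1)] B'[of j k] by simp
      then have "vert n t i = vert n True (int j) \<and> w = vert n True (int j + int k)
        \<or> vert n t i = vert n True (int j + int k) \<and> w = vert n True (int j)"
        unfolding pair by auto
      then have "w = vert n t (i + int k) \<or> w = vert n t (i - int k)" "t"
        using dir shift shift' by blast+
      then show ?R by (auto simp: stride_def)
    next
      assume "e = Spoke j"
      then have eq: "{vert n False (int j), vert n True (int j)} = {vert n t i, w}"
        using e(2) A[OF j(1)] B[OF j(1)] by simp
      then have "vert n t i = vert n False (int j) \<and> w = vert n (\<not> False) (int j)
        \<or> vert n t i = vert n True (int j) \<and> w = vert n (\<not> True) (int j)"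
        unfolding pair by auto
      then show ?R using opp by metis
    qed
  next
    assume R: ?R
    have fwd: "\<exists>e\<in>edges (gen_petersen n k). gp_ends n k e = {vert n t i, vert n t (i + stride k t)}"
      for i
    proof -
      define j where "j = nat (i mod int n)"
      have j: "j < n" "int j = i mod int n" using n by (auto simp: j_def nat_less_iff)
      have eq: "vert n t (int j) = vert n t i" "vert n t (int j + d) = vert n t (i + d)" for d
        using n j(2) by (auto simp: vert_def mod_add_left_eq)
      show ?thesis
      proof (cases t)
        case True
        have "gp_ends n k (Inner j) = {vert n t i, vert n t (i + stride k t)}"
          using True B[OF j(1)] B'[of j k] eq by (simp add: stride_def)
        then show ?thesis using j(1) by (intro bexI[of _ "Inner j"]) (auto simp: gen_petersen_def)
      next
        case False
        have "gp_ends n k (Outer j) = {vert n t i, vert n t (i + stride k t)}"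
          using False A[OF j(1)] A'[of j 1] eq by (simp add: stride_def)
        then show ?thesis using j(1) by (intro bexI[of _ "Outer j"]) (auto simp: gen_petersen_def)
      qed
    qed
    have spoke: "\<exists>e\<in>edges (gen_petersen n k). gp_ends n k e = {vert n t i, vert n (\<not> t) i}"
    proof -
      define j where "j = nat (i mod int n)"
      have j: "j < n" using n by (auto simp: j_def nat_less_iff)
      have "gp_ends n k (Spoke j) = {vert n t i, vert n (\<not> t) i}"
        by (auto simp: vert_def j_def)
      then show ?thesis using j by (intro bexI[of _ "Spoke j"]) (auto simp: gen_petersen_def)
    qed
    have [simp]: "ends (gen_petersen n k) = gp_ends n k" by (simp add: gen_petersen_def)
    from R show ?L
    proof (elim disjE)
      assume "w = vert n t (i - stride k t)"
      then show ?L using fwd[of "i - stride k t"] by (simp add: adjacent_def insert_commute)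
    qed (use fwd spoke in \<open>auto simp: adjacent_def\<close>)
  }
qed

lemma adjacent_gen_petersen_verts:
  assumes "n > 0" "adjacent (gen_petersen n k) u v"
  shows "u \<in> verts (gen_petersen n k)" "v \<in> verts (gen_petersen n k)"
proof -
  obtain e where e: "e \<in> edges (gen_petersen n k)" "gp_ends n k e = {u, v}"
    using assms(2) by (auto simp: adjacent_def gen_petersen_def)
  have "gp_ends n k e \<subseteq> verts (gen_petersen n k)"
    using e(1) assms(1) by (auto simp: gen_petersen_def)
  then show "u \<in> verts (gen_petersen n k)" "v \<in> verts (gen_petersen n k)"
    using e(2) by auto
qed

section \<open>Closed walks of length eight\<close>

text \<open>A walk of length 8 moves by at most 8 in either direction, so under this condition it
  closes in the graph only if its lift to the infinite cover closes.\<close>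

definition generic :: "nat \<Rightarrow> nat \<Rightarrow> bool" where
  "generic n k \<longleftrightarrow>
    (\<forall>x y. \<bar>x\<bar> \<le> 8 \<longrightarrow> \<bar>y\<bar> \<le> 8 \<longrightarrow> int n dvd x + y * int k \<longrightarrow> x = 0 \<and> y = 0)"

text \<open>The walk is based at \<open>x0\<close>, the only place where it may backtrack:
  \<open>x7 = x1\<close> is allowed. The parameters are the two edges whose types are to be
  compared.\<close>

definition closed8 :: "('v \<Rightarrow> 'v \<Rightarrow> bool) \<Rightarrow> 'v \<Rightarrow> 'v \<Rightarrow> 'v \<Rightarrow> bool" where
  "closed8 R x0 x1 x2 \<longleftrightarrow> (\<exists>x3 x4 x5 x6 x7.
     R x0 x1 \<and> R x1 x2 \<and> R x2 x3 \<and> R x3 x4 \<and> R x4 x5 \<and> R x5 x6 \<and> R x6 x7 \<and> R x7 x0 \<and>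
     x0 \<noteq> x2 \<and> x1 \<noteq> x3 \<and> x2 \<noteq> x4 \<and> x3 \<noteq> x5 \<and> x4 \<noteq> x6 \<and> x5 \<noteq> x7 \<and> x6 \<noteq> x0)"

lemma closed8_image:
  assumes "closed8 R x0 x1 x2"
    and "\<And>u v. R u v \<Longrightarrow> S (f u) (f v)"
    and "\<And>u v. R u v \<Longrightarrow> u \<in> V \<and> v \<in> V"
    and "inj_on f V"
  shows "closed8 S (f x0) (f x1) (f x2)"
proof -
  obtain x3 x4 x5 x6 x7 where R: "R x0 x1" "R x1 x2" "R x2 x3" "R x3 x4" "R x4 x5" "R x5 x6" "R x6 x7"
      "R x7 x0"
    and ne: "x0 \<noteq> x2" "x1 \<noteq> x3" "x2 \<noteq> x4" "x3 \<noteq> x5" "x4 \<noteq> x6" "x5 \<noteq> x7" "x6 \<noteq> x0"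
    using assms(1) by (auto simp: closed8_def)
  have V: "x0 \<in> V" "x1 \<in> V" "x2 \<in> V" "x3 \<in> V" "x4 \<in> V" "x5 \<in> V" "x6 \<in> V" "x7 \<in> V"
    using R assms(3) by blast+
  show ?thesis
    unfolding closed8_def
    by (rule exI[of _ "f x3"], rule exI[of _ "f x4"], rule exI[of _ "f x5"],
        rule exI[of _ "f x6"], rule exI[of _ "f x7"])
      (use R V ne assms(2) inj_on_eq_iff[OF assms(4)] in auto)
qed

text \<open>The bounds on \<open>x\<close> and \<open>y\<close> agree, so genericity treats the two
  rims alike.\<close>

lemma generic_stride:
  assumes "generic n k" "\<bar>x\<bar> \<le> 8" "\<bar>y\<bar> \<le> 8"
    and "int n dvd x * stride k t + y * stride k (\<not> t)"
  shows "x = 0 \<and> y = 0"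
  using assms unfolding generic_def stride_def
  by (cases t) (auto simp: add.commute)

lemma generic_strideD:
  assumes "generic n k" "\<bar>x\<bar> \<le> 8" "x \<noteq> 0"
  shows "\<not> int n dvd x * stride k t"
  using generic_stride[OF assms(1,2), of 0 t] assms(3) by auto

text \<open>Rim steps \<open>p\<close>, \<open>q\<close>, \<open>-p\<close>, \<open>-q\<close>
  alternating with spokes bound a parallelogram. Vertices two apart on this walk lie on different
  rims, so it does not backtrack.\<close>

lemma closed8_spoke:
  assumes g: "generic n k" and n: "n > 0" and e: "\<epsilon> \<in> {1, - 1}"
  shows "closed8 (adjacent (gen_petersen n k)) (vert n (\<not> t) i) (vert n t i)
    (vert n t (i + \<epsilon> * stride k t))"
proof -
  define p q where "p = \<epsilon> * stride k t" and "q = stride k (\<not> t)"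
  have "\<not> int n dvd \<epsilon> * stride k t" "\<not> int n dvd 1 * stride k (\<not> t)"
    using e generic_strideD[OF g, of \<epsilon> t] generic_strideD[OF g, of 1 "\<not> t"] by auto
  then have pq: "\<not> int n dvd p" "\<not> int n dvd q" by (simp_all add: p_def q_def)
  have p: "p = stride k t \<or> p = - stride k t" using e by (auto simp: p_def)
  show ?thesis
    unfolding closed8_def p_def[symmetric]
    by (rule exI[of _ "vert n (\<not> t) (i + p)"], rule exI[of _ "vert n (\<not> t) (i + p + q)"],
        rule exI[of _ "vert n t (i + p + q)"], rule exI[of _ "vert n t (i + q)"],
        rule exI[of _ "vert n (\<not> t) (i + q)"])
      (use n p pq in \<open>auto simp: adjacent_vert_iff vert_eq_iff q_def[symmetric]\<close>)
qed

text \<open>The neighbours in the infinite cover of the generalised Petersen graphs: two perpendicular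
  families of lines over the integer lattice, joined by spokes.\<close>

fun cover_nbrs :: "bool \<times> int \<times> int \<Rightarrow> (bool \<times> int \<times> int) list" where
  "cover_nbrs (t, x, y) =
    (if t then [(t, x, y + 1), (t, x, y - 1), (False, x, y)]
     else [(t, x + 1, y), (t, x - 1, y), (True, x, y)])"

text \<open>In the cover the smallest rectangle with a side of length two takes six rim steps and
  four spokes, hence length 10. The claim is checked by enumerating all continuations of the
  straight start (-1,0), (0,0), (1,0); the two bounds measure the displacement from (-1,0).\<close>

lemma cover_no_closed8:
  "\<forall>d3\<in>set (cover_nbrs (False, 1, 0)). d3 \<noteq> (False, 0, 0) \<longrightarrow>
   (\<forall>d4\<in>set (cover_nbrs d3). d4 \<noteq> (False, 1, 0) \<longrightarrow>
   (\<forall>d5\<in>set (cover_nbrs d4). d5 \<noteq> d3 \<longrightarrow>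
   (\<forall>d6\<in>set (cover_nbrs d5). d6 \<noteq> d4 \<longrightarrow>
   (\<forall>d7\<in>set (cover_nbrs d6). d7 \<noteq> d5 \<longrightarrow>
   (\<forall>d8\<in>set (cover_nbrs d7). d8 \<noteq> d6 \<longrightarrow>
      d8 \<noteq> (False, - 1, 0) \<and> \<bar>fst (snd d8) + 1\<bar> \<le> 8 \<and> \<bar>snd (snd d8)\<bar> \<le> 8)))))"
  by code_simp

lemma not_closed8_straight:
  assumes g: "generic n k" and n: "n > 0" and e: "\<epsilon> \<in> {1, - 1}"
  shows "\<not> closed8 (adjacent (gen_petersen n k)) (vert n t (i - \<epsilon> * stride k t)) (vert n t i)
    (vert n t (i + \<epsilon> * stride k t))"
proof
  define p q where "p = \<epsilon> * stride k t" and "q = stride k (\<not> t)"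
  have p: "p = stride k t \<or> p = - stride k t" using e by (auto simp: p_def)
  \<comment> \<open>The covering map, turned so that the horizontal lines cover rim \<open>t\<close>
    and the direction \<open>\<epsilon>\<close> is positive: \<open>s \<noteq> t\<close> equals
    \<open>t\<close> for \<open>s = False\<close>.\<close>
  define W where "W = (\<lambda>(s, x, y). vert n (s \<noteq> t) (i + x * p + y * q))"
  let ?R = "adjacent (gen_petersen n k)"
  have lift: "\<exists>d\<in>set (cover_nbrs c). w = W d" if "?R (W c) w" for c w
  proof -
    obtain s x y where c: "c = (s, x, y)" by (cases c)
    have "?R (vert n (s \<noteq> t) (i + x * p + y * q)) w" using that by (simp add: c W_def)
    then have "w = vert n (s \<noteq> t) (i + x * p + y * q + stride k (s \<noteq> t)) \<or>
        w = vert n (s \<noteq> t) (i + x * p + y * q - stride k (s \<noteq> t)) \<or>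
        w = vert n ((\<not> s) \<noteq> t) (i + x * p + y * q)"
      using n by (auto simp: adjacent_vert_iff)
    then show ?thesis
      using p by (cases s) (auto simp: c W_def algebra_simps q_def)
  qed
  assume "closed8 ?R (vert n t (i - \<epsilon> * stride k t)) (vert n t i) (vert n t (i + \<epsilon> * stride k t))"
  moreover have "vert n t (i - \<epsilon> * stride k t) = W (False, - 1, 0)" "vert n t i = W (False, 0, 0)"
    "vert n t (i + \<epsilon> * stride k t) = W (False, 1, 0)"
    by (simp_all add: W_def p_def)
  ultimately have "closed8 ?R (W (False, - 1, 0)) (W (False, 0, 0)) (W (False, 1, 0))"
    by simp
  then obtain x3 x4 x5 x6 x7 where R: "?R (W (False, 1, 0)) x3" "?R x3 x4" "?R x4 x5" "?R x5 x6"
      "?R x6 x7" "?R x7 (W (False, - 1, 0))"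
    and ne: "W (False, 0, 0) \<noteq> x3" "W (False, 1, 0) \<noteq> x4" "x3 \<noteq> x5" "x4 \<noteq> x6" "x5 \<noteq> x7"
      "x6 \<noteq> W (False, - 1, 0)"
    unfolding closed8_def by blast
  obtain d3 where d3: "d3 \<in> set (cover_nbrs (False, 1, 0))" "x3 = W d3" using lift R(1) by blast
  obtain d4 where d4: "d4 \<in> set (cover_nbrs d3)" "x4 = W d4" using lift R(2) d3(2) by blast
  obtain d5 where d5: "d5 \<in> set (cover_nbrs d4)" "x5 = W d5" using lift R(3) d4(2) by blast
  obtain d6 where d6: "d6 \<in> set (cover_nbrs d5)" "x6 = W d6" using lift R(4) d5(2) by blast
  obtain d7 where d7: "d7 \<in> set (cover_nbrs d6)" "x7 = W d7" using lift R(5) d6(2) by blast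
  obtain d8 where d8: "d8 \<in> set (cover_nbrs d7)" "W (False, - 1, 0) = W d8"
    using lift R(6) d7(2) by blast
  have "d3 \<noteq> (False, 0, 0)" "d4 \<noteq> (False, 1, 0)" "d5 \<noteq> d3" "d6 \<noteq> d4" "d7 \<noteq> d5" "d8 \<noteq> d6"
    using ne d3(2) d4(2) d5(2) d6(2) d7(2) d8(2) by auto
  then have far: "d8 \<noteq> (False, - 1, 0)" "\<bar>fst (snd d8) + 1\<bar> \<le> 8" "\<bar>snd (snd d8)\<bar> \<le> 8"
    using cover_no_closed8 d3(1) d4(1) d5(1) d6(1) d7(1) d8(1) by blast+
  obtain s x y where sxy: "d8 = (s, x, y)" by (cases d8)
  have "\<not> s" "int n dvd (i - p) - (i + x * p + y * q)"
    using d8(2) n by (auto simp: sxy W_def vert_eq_iff)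
  then have "int n dvd (x + 1) * p + y * q"
    using dvd_minus_iff[of "int n" "(x + 1) * p + y * q"] by (simp add: algebra_simps)
  \<comment> \<open>Both ends of the lifted walk lie over the same vertex, so their displacement is
    a short relation, which genericity makes trivial.\<close>
  then have "int n dvd ((x + 1) * \<epsilon>) * stride k t + y * stride k (\<not> t)"
    by (simp add: p_def q_def mult.assoc)
  moreover have "\<bar>(x + 1) * \<epsilon>\<bar> \<le> 8" "\<bar>y\<bar> \<le> 8" using far(2,3) e by (auto simp: sxy)
  ultimately have "(x + 1) * \<epsilon> = 0 \<and> y = 0" using generic_stride[OF g] by blast
  then show False using far(1) \<open>\<not> s\<close> e by (auto simp: sxy)
qed

section \<open>Embeddings preserve spokes\<close>

text \<open>This covers both isomorphisms between two of the graphs and automorphisms of one. Walks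
  are transported forwards only, so one implication suffices.\<close>

definition gp_embedding :: "nat \<Rightarrow> nat \<Rightarrow> nat \<Rightarrow> (gp_vertex \<Rightarrow> gp_vertex) \<Rightarrow> bool" where
  "gp_embedding n k l f \<longleftrightarrow> inj_on f (verts (gen_petersen n k)) \<and>
     (\<forall>u v. adjacent (gen_petersen n k) u v \<longrightarrow> adjacent (gen_petersen n l) (f u) (f v))"

lemma gp_embedding_eq_iff:
  assumes "gp_embedding n k l f" "n > 0"
  shows "f (vert n s i) = f (vert n t j) \<longleftrightarrow> vert n s i = vert n t j"
  using assms inj_on_eq_iff[OF _ vert_in_verts vert_in_verts] unfolding gp_embedding_def by blast

text \<open>If the spoke at a vertex went to a rim edge, some rim edge at that vertex would go to
  the opposite rim edge. The closed walk through the spoke and this rim edge would then have a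
  straight image, which is impossible.\<close>

lemma gp_embedding_spoke:
  assumes gk: "generic n k" and gl: "generic n l" and n: "n > 0" and f: "gp_embedding n k l f"
    and fv: "f (vert n s i) = vert n t c"
  shows "f (vert n (\<not> s) i) = vert n (\<not> t) c"
proof (rule ccontr)
  assume no: "f (vert n (\<not> s) i) \<noteq> vert n (\<not> t) c"
  define u p m where "u = vert n (\<not> s) i" and "p = vert n s (i + 1 * stride k s)"
    and "m = vert n s (i + (- 1) * stride k s)"
  have adj: "adjacent (gen_petersen n k) (vert n s i) w \<Longrightarrow>
      adjacent (gen_petersen n l) (vert n t c) (f w)" for w
    using f fv unfolding gp_embedding_def by metis
  have nb: "f w = vert n t (c + stride l t) \<or> f w = vert n t (c - stride l t) \<or> f w = vert n (\<not> t) c"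
    if "w \<in> {u, p, m}" for w
    using adj[of w] that n by (auto simp: adjacent_vert_iff u_def p_def m_def)
  have "\<not> int n dvd 2 * stride k s" using generic_strideD[OF gk, of 2] by simp
  then have "u \<noteq> p" "u \<noteq> m" "p \<noteq> m"
    using n by (auto simp: u_def p_def m_def vert_eq_iff)
  then have ne: "f u \<noteq> f p" "f u \<noteq> f m" "f p \<noteq> f m"
    using gp_embedding_eq_iff[OF f n] by (simp_all add: u_def p_def m_def)
  obtain \<epsilon> :: int where e: "\<epsilon> \<in> {1, - 1}" and fu: "f u = vert n t (c - \<epsilon> * stride l t)"
  proof -
    from nb[of u] no consider "f u = vert n t (c + stride l t)" | "f u = vert n t (c - stride l t)"
      by (auto simp: u_def)
    then show thesis
      by cases (use that[of 1] that[of "- 1"] in auto)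
  qed
  \<comment> \<open>The three neighbours have distinct images among three candidates, so all
    candidates are attained, and \<open>u\<close> already takes one.\<close>
  have w: "\<exists>w\<in>{p, m}. f w = vert n t (c + \<epsilon> * stride l t)"
    using nb[of p] nb[of m] nb[of u] ne e fu by auto
  have closed: "closed8 (adjacent (gen_petersen n k)) u (vert n s i) w" if "w \<in> {p, m}" for w
    using that closed8_spoke[OF gk n, of 1 s i] closed8_spoke[OF gk n, of "- 1" s i]
    by (auto simp: u_def p_def m_def)
  have "closed8 (adjacent (gen_petersen n l)) (f u) (f (vert n s i)) (f w)" if "w \<in> {p, m}" for w
    by (rule closed8_image[OF closed[OF that], where V = "verts (gen_petersen n k)"])
      (use f n adjacent_gen_petersen_verts in \<open>auto simp: gp_embedding_def\<close>)
  then show False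
    using w fu fv not_closed8_straight[OF gl n e] by metis
qed

text \<open>The spoke is already the image of a spoke, so each rim edge stays on rim
  \<open>t\<close>; injectivity forbids turning back, so the first step fixes the direction.\<close>

lemma gp_embedding_line:
  assumes gk: "generic n k" and gl: "generic n l" and n: "n > 0" and f: "gp_embedding n k l f"
    and f0: "f (vert n False 0) = vert n t c"
  obtains \<epsilon> :: int where "\<epsilon> \<in> {1, - 1}"
    and "\<And>i::nat. f (vert n False (int i)) = vert n t (c + \<epsilon> * stride l t * int i)"
proof -
  have step: "f (vert n False (j + 1)) = vert n t (d + stride l t) \<or>
      f (vert n False (j + 1)) = vert n t (d - stride l t)"
    if "f (vert n False j) = vert n t d" for j d
  proof -
    have "f (vert n True j) = vert n (\<not> t) d"
      using gp_embedding_spoke[OF gk gl n f that] by simp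
    then have "f (vert n False (j + 1)) \<noteq> vert n (\<not> t) d"
      using gp_embedding_eq_iff[OF f n, of False "j + 1" True j] n by (auto simp: vert_eq_iff)
    moreover have "adjacent (gen_petersen n k) (vert n False j) (vert n False (j + 1))"
      using n by (simp add: adjacent_vert_iff stride_def)
    then have "adjacent (gen_petersen n l) (vert n t d) (f (vert n False (j + 1)))"
      using f that unfolding gp_embedding_def by metis
    ultimately show ?thesis using n by (auto simp: adjacent_vert_iff)
  qed
  obtain \<epsilon> :: int where e: "\<epsilon> \<in> {1, - 1}" and f1: "f (vert n False 1) = vert n t (c + \<epsilon> * stride l t)"
    using step[OF f0] that[of 1] by (metis add.left_neutral add_uminus_conv_diff insertCI mult_1
        mult_minus1)
  \<comment> \<open>Two consecutive positions are carried along, because the earlier one excludes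
    the backward step.\<close>
  have "f (vert n False (int i)) = vert n t (c + \<epsilon> * stride l t * int i) \<and>
      f (vert n False (int i + 1)) = vert n t (c + \<epsilon> * stride l t * (int i + 1))" for i
  proof (induction i)
    case 0
    then show ?case using f0 f1 by simp
  next
    case (Suc i)
    let ?d = "c + \<epsilon> * stride l t * (int i + 1)"
    have "\<not> int n dvd 2 * stride k False" using generic_strideD[OF gk, of 2] by simp
    then have "vert n False (int i + 1 + 1) \<noteq> vert n False (int i)"
      using n by (simp add: vert_eq_iff stride_def)
    then have "f (vert n False (int i + 1 + 1)) \<noteq> f (vert n False (int i))"
      using gp_embedding_eq_iff[OF f n] by simp
    moreover have "f (vert n False (int i)) = vert n t (?d - \<epsilon> * stride l t)"
      using Suc by (simp add: algebra_simps)
    ultimately have "f (vert n False (int i + 1 + 1)) = vert n t (?d + \<epsilon> * stride l t)"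
      using step[of "int i + 1" ?d] Suc e by auto
    then show ?case using Suc by (simp add: algebra_simps)
  qed
  then show thesis using that e by blast
qed

text \<open>Spokes transfer the image of the outer rim to the other rim. The inner vertices 0 and
  \<open>k\<close> are adjacent, so their images, \<open>stride l t * k\<close> apart up to sign,
  differ by one step \<open>stride l (\<not> t)\<close> of that rim.\<close>

lemma gp_embedding_cong:
  assumes gk: "generic n k" and gl: "generic n l" and n: "n > 0" and f: "gp_embedding n k l f"
    and f0: "f (vert n False 0) = vert n t c"
  shows "int n dvd stride l t * int k - stride l (\<not> t) \<or> int n dvd stride l t * int k + stride l (\<not> t)"
proof -
  obtain \<epsilon> :: int where e: "\<epsilon> \<in> {1, - 1}"
    and line: "\<And>i::nat. f (vert n False (int i)) = vert n t (c + \<epsilon> * stride l t * int i)"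
    using gp_embedding_line[OF gk gl n f f0] by blast
  have "f (vert n True 0) = vert n (\<not> t) c"
    "f (vert n True (int k)) = vert n (\<not> t) (c + \<epsilon> * stride l t * int k)"
    using gp_embedding_spoke[OF gk gl n f f0] gp_embedding_spoke[OF gk gl n f line[of k]] by simp_all
  moreover have "adjacent (gen_petersen n k) (vert n True 0) (vert n True (int k))"
    using n by (simp add: adjacent_vert_iff stride_def)
  ultimately have "adjacent (gen_petersen n l) (vert n (\<not> t) c)
      (vert n (\<not> t) (c + \<epsilon> * stride l t * int k))"
    using f unfolding gp_embedding_def by metis
  then have "int n dvd \<epsilon> * stride l t * int k - stride l (\<not> t) \<or>
      int n dvd \<epsilon> * stride l t * int k + stride l (\<not> t)"
    using n by (auto simp: adjacent_vert_iff vert_eq_iff)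
  then show ?thesis
    using e dvd_minus_iff[of "int n" "stride l t * int k - stride l (\<not> t)"]
      dvd_minus_iff[of "int n" "stride l t * int k + stride l (\<not> t)"]
    by auto
qed

lemma multigraph_iso_adjacent:
  assumes "multigraph_iso X Y"
  obtains f where "bij_betw f (verts X) (verts Y)"
    and "\<And>u v. adjacent X u v \<Longrightarrow> adjacent Y (f u) (f v)"
proof -
  obtain f \<phi> where f: "bij_betw f (verts X) (verts Y)" and p: "bij_betw \<phi> (edges X) (edges Y)"
    and e: "\<forall>e\<in>edges X. ends Y (\<phi> e) = f ` ends X e"
    using assms unfolding multigraph_iso_def by blast
  have "adjacent Y (f u) (f v)" if uv: "adjacent X u v" for u v
  proof -
    obtain d where d: "d \<in> edges X" "ends X d = {u, v}" using uv by (auto simp: adjacent_def)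
    then have "\<phi> d \<in> edges Y" "ends Y (\<phi> d) = {f u, f v}"
      using p e by (auto dest: bij_betwE)
    then show ?thesis by (auto simp: adjacent_def)
  qed
  then show thesis using that f by blast
qed

lemma gen_petersen_iso_generic:
  assumes n: "n > 0" and gk: "generic n k" and gl: "generic m l"
    and iso: "multigraph_iso (gen_petersen n k) (gen_petersen m l)"
  shows "n = m"
    and "int n dvd int k - int l \<or> int n dvd int k + int l \<or>
      int n dvd int l * int k - 1 \<or> int n dvd int l * int k + 1"
proof -
  obtain f where f: "bij_betw f (verts (gen_petersen n k)) (verts (gen_petersen m l))"
    and adj: "\<And>u v. adjacent (gen_petersen n k) u v \<Longrightarrow> adjacent (gen_petersen m l) (f u) (f v)"
    using multigraph_iso_adjacent[OF iso] by blast
  show nm: "n = m" using bij_betw_same_card[OF f] by (simp add: card_verts_gen_petersen)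
  have emb: "gp_embedding n k l f"
    using f adj nm by (auto simp: gp_embedding_def bij_betw_def)
  have "f (vert n False 0) \<in> verts (gen_petersen n l)"
    using f n nm vert_in_verts[of n False 0 k] by (auto dest: bij_betwE)
  then obtain t c where "f (vert n False 0) = vert n t c" using vert_exhaust by blast
  then show "int n dvd int k - int l \<or> int n dvd int k + int l \<or>
      int n dvd int l * int k - 1 \<or> int n dvd int l * int k + 1"
    using gp_embedding_cong[OF gk _ n emb, of t c] gl nm by (cases t) (auto simp: stride_def)
qed

section \<open>Cayley graphs are vertex-transitive\<close>

lemma cayley_graph_translation:
  fixes G (structure)
  assumes "group G" "connection_set G S" "h \<in> carrier G" "adjacent (cayley_graph G S) x y"
  shows "adjacent (cayley_graph G S) (h \<otimes> x) (h \<otimes> y)"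
proof -
  interpret group G by fact
  have S: "S \<subseteq> carrier G" using assms(2) by (simp add: connection_set_def)
  obtain g s where g: "g \<in> carrier G" "s \<in> S" "{g, g \<otimes> s} = {x, y}"
    using assms(4) by (auto simp: adjacent_def cayley_graph_def)
  then have "{h \<otimes> x, h \<otimes> y} = {h \<otimes> g, h \<otimes> (g \<otimes> s)}"
    by (auto simp: doubleton_eq_iff)
  also have "\<dots> = {h \<otimes> g, (h \<otimes> g) \<otimes> s}" using g S assms(3) by (auto simp: m_assoc)
  finally show ?thesis
    using g assms(3) unfolding adjacent_def cayley_graph_def multigraph.simps by blast
qed

lemma cayley_vertex_transitive:
  assumes cay: "is_cayley_graph X" and wf: "\<And>e. e \<in> edges X \<Longrightarrow> ends X e \<subseteq> verts X"
    and uv: "u \<in> verts X" "v \<in> verts X"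
  obtains F where "bij_betw F (verts X) (verts X)"
    and "\<And>x y. adjacent X x y \<Longrightarrow> adjacent X (F x) (F y)" and "F u = v"
proof -
  obtain G :: "'a monoid" and S where G: "group G" and S: "connection_set G S"
    and iso: "multigraph_iso X (cayley_graph G S)"
    using cay unfolding is_cayley_graph_def by blast
  interpret group G by fact
  let ?C = "cayley_graph G S"
  have vC: "verts ?C = carrier G" by (simp add: cayley_graph_def)
  obtain f where f: "bij_betw f (verts X) (carrier G)"
    and fadj: "\<And>x y. adjacent X x y \<Longrightarrow> adjacent ?C (f x) (f y)"
    using multigraph_iso_adjacent[OF iso] vC by metis
  obtain g where g: "bij_betw g (carrier G) (verts X)"
    and gadj: "\<And>x y. adjacent ?C x y \<Longrightarrow> adjacent X (g x) (g y)"
    using multigraph_iso_adjacent[OF multigraph_iso_sym[OF wf iso]] vC by metis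
  \<comment> \<open>\<open>g\<close> need not be inverse to \<open>f\<close>, so the translation has
    to take \<open>f u\<close> to a preimage of \<open>v\<close> under \<open>g\<close>.\<close>
  obtain w where w: "w \<in> carrier G" "g w = v" using g uv(2) by (metis bij_betw_def imageE)
  have fu: "f u \<in> carrier G" using f uv(1) by (auto dest: bij_betwE)
  define h where "h = w \<otimes>\<^bsub>G\<^esub> inv\<^bsub>G\<^esub> (f u)"
  have h: "h \<in> carrier G" "h \<otimes>\<^bsub>G\<^esub> f u = w" using w fu by (auto simp: h_def m_assoc)
  have "bij_betw (\<lambda>x. h \<otimes>\<^bsub>G\<^esub> x) (carrier G) (carrier G)"
    by (rule bij_betw_byWitness[where f' = "\<lambda>x. inv\<^bsub>G\<^esub> h \<otimes>\<^bsub>G\<^esub> x"])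
      (use h in \<open>auto simp flip: m_assoc\<close>)
  then have "bij_betw (g \<circ> ((\<lambda>x. h \<otimes>\<^bsub>G\<^esub> x) \<circ> f)) (verts X) (verts X)"
    using f g by (blast intro: bij_betw_trans)
  then show thesis
    by (rule that) (use cayley_graph_translation[OF G S h(1)] fadj gadj h(2) w in auto)
qed

text \<open>Transitivity yields an automorphism taking an outer vertex to an inner one, which is the
  case \<open>t = True\<close>, \<open>l = k\<close> of the congruence.\<close>

lemma cayley_gen_petersen_generic:
  assumes n: "n > 0" and g: "generic n k" and cay: "is_cayley_graph (gen_petersen n k)"
  shows "int n dvd (int k)\<^sup>2 - 1 \<or> int n dvd (int k)\<^sup>2 + 1"
proof -
  have wf: "ends (gen_petersen n k) e \<subseteq> verts (gen_petersen n k)"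
    if "e \<in> edges (gen_petersen n k)" for e
    using that n by (auto simp: gen_petersen_def)
  obtain F where F: "bij_betw F (verts (gen_petersen n k)) (verts (gen_petersen n k))"
    "\<And>x y. adjacent (gen_petersen n k) x y \<Longrightarrow> adjacent (gen_petersen n k) (F x) (F y)"
    "F (vert n False 0) = vert n True 0"
    using cayley_vertex_transitive[OF cay wf vert_in_verts[OF n] vert_in_verts[OF n]] by blast
  then have "gp_embedding n k k F" by (auto simp: gp_embedding_def bij_betw_def)
  from gp_embedding_cong[OF g g n this F(3)] show ?thesis
    by (simp add: stride_def power2_eq_square)
qed

section \<open>Counting\<close>

lemma card_divisors_le:
  fixes n :: nat
  assumes n: "n > 0"
  shows "real (card {d. d dvd n}) \<le> 2 * sqrt (real n)"
proof -
  define r where "r = nat \<lfloor>sqrt (real n)\<rfloor>"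
  have r: "real r \<le> sqrt (real n)" "sqrt (real n) < real r + 1"
    unfolding r_def by (simp_all add: of_nat_nat)
  have "{d. d dvd n} \<subseteq> {1..r} \<union> (\<lambda>d. n div d) ` {1..r}"
  proof
    fix d assume "d \<in> {d. d dvd n}"
    then obtain e where e: "n = d * e" by auto
    then have pos: "d > 0" "e > 0" using n by auto
    have "d \<le> r \<or> e \<le> r"
    proof (rule ccontr)
      assume "\<not> ?thesis"
      then have "real r + 1 \<le> real d" "real r + 1 \<le> real e" by linarith+
      then have "sqrt (real n) < real d" "sqrt (real n) < real e" using r by linarith+
      then have "sqrt (real n) * sqrt (real n) < real d * real e"
        using pos by (intro mult_strict_mono) auto
      then show False using e by simp
    qed
    moreover have "d = n div e" using e pos by simp
    ultimately show "d \<in> {1..r} \<union> (\<lambda>d. n div d) ` {1..r}"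
      using pos by force
  qed
  then have "card {d. d dvd n} \<le> card ({1..r} \<union> (\<lambda>d. n div d) ` {1..r})"
    by (rule card_mono[rotated]) simp
  also have "\<dots> \<le> r + r"
    using card_Un_le[of "{1..r}" "(\<lambda>d. n div d) ` {1..r}"] card_image_le[of "{1..r}" "\<lambda>d. n div d"]
    by simp
  finally show ?thesis using r(1) by linarith
qed

text \<open>With \<open>d\<close> the common gcd and \<open>n = d * e\<close>, the factor
  \<open>e\<close> is coprime to \<open>(k - k0) / d\<close>, so it divides \<open>k + k0\<close>,
  and likewise \<open>k' + k0\<close>. Hence \<open>lcm d e\<close> divides \<open>k - k'\<close>.
  Moreover \<open>gcd d e\<close> divides both \<open>2 * k0\<close> and \<open>k0^2 - c\<close>,
  hence 2, and \<open>n = gcd d e * lcm d e\<close>.\<close>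

lemma sqrt_mod_unique:
  fixes n c k k' k0 :: int
  assumes n: "n > 0" and c: "c \<in> {1, - 1}"
    and sq: "n dvd k\<^sup>2 - c" "n dvd k'\<^sup>2 - c" "n dvd k0\<^sup>2 - c"
    and eq: "gcd n (k - k0) = gcd n (k' - k0)"
  shows "n dvd 2 * (k - k')"
proof -
  define d where "d = gcd n (k - k0)"
  obtain e where e: "n = d * e" by (metis d_def dvdE gcd_dvd1)
  have d0: "d > 0" using n by (simp add: d_def)
  have codiv: "e dvd x + k0" if x: "n dvd x\<^sup>2 - c" "gcd n (x - k0) = d" for x
  proof -
    obtain a where a: "x - k0 = d * a" using x(2) by (metis dvdE gcd_dvd2)
    have "d * gcd e a = d"
      using gcd_mult_distrib_int[of d e a] d0 x(2) unfolding e[symmetric] a[symmetric] by simp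
    then have "coprime e a" using d0 by (simp add: coprime_iff_gcd_eq_1)
    moreover have "n dvd (x - k0) * (x + k0)"
      using dvd_diff[OF x(1) sq(3)] by (simp add: power2_eq_square algebra_simps)
    then have "d * e dvd d * (a * (x + k0))" by (simp only: e a mult.assoc)
    then have "e dvd a * (x + k0)" using d0 by simp
    ultimately show ?thesis by (simp add: coprime_dvd_mult_right_iff)
  qed
  have kk: "e dvd k + k0" "e dvd k' + k0"
    by (rule codiv[OF sq(1) d_def[symmetric]], rule codiv[OF sq(2) eq[symmetric, folded d_def]])
  have dd: "d dvd k - k0" "d dvd k' - k0"
    unfolding d_def by (rule gcd_dvd2, unfold eq, rule gcd_dvd2)
  have "e dvd k - k'" "d dvd k - k'"
    using dvd_diff[OF kk] dvd_diff[OF dd] by simp_all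
  then have lcm: "lcm d e dvd k - k'" by (simp add: lcm_least)
  define g where "g = gcd d e"
  have "g dvd k - k0" "g dvd k + k0" "g dvd n"
    unfolding g_def e
    by (rule dvd_trans[OF gcd_dvd1 dd(1)], rule dvd_trans[OF gcd_dvd2 kk(1)], rule dvd_mult2[OF gcd_dvd1])
  then have "g dvd 2 * k0" "g dvd k0\<^sup>2 - c"
    using dvd_diff[of g "k + k0" "k - k0"] dvd_trans[OF _ sq(3)] by simp_all
  then have "g dvd (2 * k0) * k0 - 2 * (k0\<^sup>2 - c)" by (meson dvd_diff dvd_mult dvd_mult2)
  then have "g dvd 2 * c" by (simp add: power2_eq_square algebra_simps)
  then have "g dvd 2" using c by auto
  then have "g * lcm d e dvd 2 * (k - k')" using lcm by (rule mult_dvd_mono)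
  moreover have "n dvd g * lcm d e" by (simp add: g_def e flip: abs_mult)
  ultimately show ?thesis using dvd_trans by blast
qed

lemma card_sqrt_mod_le:
  assumes n: "n > 0" and c: "c \<in> {1, - 1 :: int}"
  shows "card {k. 1 \<le> k \<and> 2 * k \<le> n \<and> int n dvd (int k)\<^sup>2 - c} \<le> card {d. d dvd n}" (is "card ?S \<le> _")
proof (cases "?S = {}")
  case False
  then obtain k0 where k0: "k0 \<in> ?S" by blast
  define \<phi> where "\<phi> k = nat (gcd (int n) (int k - int k0))" for k
  have "inj_on \<phi> ?S"
  proof
    fix k k' assume k: "k \<in> ?S" "k' \<in> ?S" "\<phi> k = \<phi> k'"
    then have eq: "gcd (int n) (int k - int k0) = gcd (int n) (int k' - int k0)"
      unfolding \<phi>_def by (metis gcd_ge_0_int nat_0_le)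
    have "int n dvd (int k)\<^sup>2 - c" "int n dvd (int k')\<^sup>2 - c" "int n dvd (int k0)\<^sup>2 - c"
      using k(1,2) k0 by blast+
    then have dvd: "int n dvd 2 * (int k - int k')"
      by (rule sqrt_mod_unique[OF _ c _ _ _ eq, rotated]) (use n in simp)
    \<comment> \<open>The range \<open>2 * k \<le> n\<close> absorbs the factor 2 lost in the
      congruence.\<close>
    have "\<bar>2 * (int k - int k')\<bar> < int n" using k by auto
    then have "2 * (int k - int k') = 0" by (metis dvd dvd_imp_le_int abs_of_nat not_le)
    then show "k = k'" by simp
  qed
  moreover have "\<phi> k dvd n" for k unfolding \<phi>_def nat_dvd_iff by simp
  then have "\<phi> ` ?S \<subseteq> {d. d dvd n}" by blast
  moreover have "finite {d. d dvd n}" using n by simp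
  ultimately show ?thesis by (rule card_inj_on_le)
next
  case True
  show ?thesis unfolding True by simp
qed

text \<open>For \<open>n > 8\<close> a short relation \<open>x + y k = n t\<close> has \<open>y \<noteq> 0\<close> and \<open>\<bar>t\<bar> \<le> 16\<close>, and
  \<open>(x, y, t)\<close> determines \<open>k\<close>; there are \<open>17 * 17 * 33 = 9537\<close> such triples.\<close>

lemma card_not_generic_le: "card {k. 1 \<le> k \<and> 2 * k \<le> n \<and> \<not> generic n k} \<le> 9537" (is "card ?S \<le> _")
proof (cases "n \<le> 8")
  case True
  then have "?S \<subseteq> {1..4}" by auto
  then have "card ?S \<le> card {1..4::nat}" by (rule card_mono[rotated]) simp
  then show ?thesis by simp
next
  case False
  define T :: "(int \<times> int \<times> int) set" where "T = {- 8..8} \<times> {- 8..8} \<times> {- 16..16}"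
  have "?S \<subseteq> (\<lambda>(x, y, t). nat ((int n * t - x) div y)) ` T"
  proof
    fix k assume "k \<in> ?S"
    then have k: "1 \<le> k" "2 * k \<le> n" "\<not> generic n k" by auto
    from k(3) obtain x y where xy: "\<bar>x\<bar> \<le> 8" "\<bar>y\<bar> \<le> 8" "int n dvd x + y * int k" "\<not> (x = 0 \<and> y = 0)"
      unfolding generic_def by blast
    from xy(3) obtain t where t: "x + y * int k = int n * t" by blast
    have y: "y \<noteq> 0"
    proof
      assume "y = 0"
      then have "x \<noteq> 0" "int n dvd x" using xy by auto
      then have "int n \<le> \<bar>x\<bar>" using dvd_imp_le_int by force
      then show False using xy(1) False by linarith
    qed
    have "\<bar>y * int k\<bar> \<le> 8 * int n"
      unfolding abs_mult using xy(2) k(2) by (intro mult_mono) auto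
    then have "\<bar>int n * t\<bar> \<le> int n * 16" using xy(1) False t by linarith
    then have "\<bar>t\<bar> \<le> 16" using False by (simp add: abs_mult)
    moreover have "int k = (int n * t - x) div y"
      using y by (simp flip: t)
    then have "k = nat ((int n * t - x) div y)" by simp
    ultimately show "k \<in> (\<lambda>(x, y, t). nat ((int n * t - x) div y)) ` T"
      using xy by (intro image_eqI[of _ _ "(x, y, t)"]) (auto simp: T_def abs_le_iff)
  qed
  moreover have "finite T" by (simp add: T_def)
  ultimately have "card ?S \<le> card T"
    by (meson card_image_le card_mono finite_imageI le_trans)
  then show ?thesis by (simp add: T_def)
qed

section \<open>Upper bound for the Cayley graphs\<close>

lemma card_cayley_le:
  assumes n: "n > 0"
  shows "real (card {k. 1 \<le> k \<and> 2 * k \<le> n \<and> is_cayley_graph (gen_petersen n k)})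
    \<le> 9537 + 4 * sqrt (real n)" (is "real (card ?S) \<le> _")
proof -
  let ?G = "{k. 1 \<le> k \<and> 2 * k \<le> n \<and> \<not> generic n k}"
  let ?Q = "\<lambda>c. {k. 1 \<le> k \<and> 2 * k \<le> n \<and> int n dvd (int k)\<^sup>2 - c}"
  have fin: "finite {k. 1 \<le> k \<and> 2 * k \<le> n \<and> P k}" for P
    by (rule finite_subset[of _ "{..n}"]) auto
  have "?S \<subseteq> ?G \<union> (?Q 1 \<union> ?Q (- 1))"
    using cayley_gen_petersen_generic[OF n] by auto
  then have "card ?S \<le> card (?G \<union> (?Q 1 \<union> ?Q (- 1)))"
    by (rule card_mono[rotated]) (intro finite_UnI fin)
  also have "\<dots> \<le> card ?G + (card (?Q 1) + card (?Q (- 1)))"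
    by (meson add_left_mono card_Un_le le_trans)
  also have "\<dots> \<le> 9537 + (card {d. d dvd n} + card {d. d dvd n})"
    by (intro add_mono card_not_generic_le card_sqrt_mod_le n) auto
  finally have "real (card ?S) \<le> 9537 + 2 * real (card {d. d dvd n})" by linarith
  then show ?thesis using card_divisors_le[OF n] by linarith
qed

text \<open>For an upper bound, counting parameter pairs instead of isomorphism classes is
  enough.\<close>

lemma num_cayley_gen_petersen_le:
  "real (num_cayley_gen_petersen N) \<le> real N * (9537 + 4 * sqrt (real N))"
proof -
  let ?X = "{X \<in> gen_petersen_upto N. is_cayley_graph X}"
  let ?K = "\<lambda>n. {k. 1 \<le> k \<and> 2 * k \<le> n \<and> is_cayley_graph (gen_petersen n k)}"
  have finK: "finite (?K n)" for n by (rule finite_subset[of _ "{..n}"]) auto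
  have finX: "finite ?X" using finite_gen_petersen_upto by simp
  have "num_cayley_gen_petersen N \<le> card ?X"
    unfolding num_cayley_gen_petersen_def num_iso_classes_def quotient_def
    using card_UN_le[OF finX, of "\<lambda>x. {{(X, Y). X \<in> ?X \<and> Y \<in> ?X \<and> multigraph_iso X Y} `` {x}}"]
    by simp
  also have "\<dots> \<le> card (SIGMA n:{1..N}. ?K n)"
  proof (rule surj_card_le)
    show "?X \<subseteq> (\<lambda>(n, k). gen_petersen n k) ` (SIGMA n:{1..N}. ?K n)"
      by (fastforce simp: gen_petersen_upto_def image_iff)
  qed (intro finite_SigmaI finK, simp)
  also have "\<dots> = (\<Sum>n=1..N. card (?K n))" by (intro card_SigmaI ballI finK) simp
  finally have "real (num_cayley_gen_petersen N) \<le> (\<Sum>n=1..N. real (card (?K n)))"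
    by (simp flip: of_nat_sum)
  also have "\<dots> \<le> (\<Sum>n=1..N. 9537 + 4 * sqrt (real N))"
  proof (rule sum_mono)
    fix n assume n: "n \<in> {1..N}"
    then have "real (card (?K n)) \<le> 9537 + 4 * sqrt (real n)" using card_cayley_le[of n] by simp
    also have "\<dots> \<le> 9537 + 4 * sqrt (real N)" using n by simp
    finally show "real (card (?K n)) \<le> 9537 + 4 * sqrt (real N)" .
  qed
  finally show ?thesis by simp
qed

section \<open>Lower bound for the isomorphism classes\<close>

text \<open>For even \<open>n\<close> the congruences \<open>k l \<equiv> \<plusminus>1\<close> have no even solutions, so only
  \<open>k \<equiv> \<plusminus>l\<close> is left.\<close>

lemma gen_petersen_even_iso:
  assumes "m > 0" "generic (2 * m) (2 * j)" "generic (2 * m') (2 * j')"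
    and j: "1 \<le> j" "2 * j \<le> m" "1 \<le> j'" "2 * j' \<le> m'"
    and iso: "multigraph_iso (gen_petersen (2 * m) (2 * j)) (gen_petersen (2 * m') (2 * j'))"
  shows "m = m' \<and> j = j'"
proof -
  have m: "m = m'" using gen_petersen_iso_generic(1)[OF _ assms(2,3) iso] assms(1) by simp
  have even: "even z" if "int (2 * m) dvd z" for z
    by (rule dvd_trans[OF _ that]) simp
  have "\<not> int (2 * m) dvd int (2 * j') * int (2 * j) - 1" "\<not> int (2 * m) dvd int (2 * j') * int (2 * j) + 1"
    using even by fastforce+
  then have "int (2 * m) dvd int (2 * j) - int (2 * j') \<or> int (2 * m) dvd int (2 * j) + int (2 * j')"
    using gen_petersen_iso_generic(2)[OF _ assms(2,3) iso] assms(1)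
    by (meson nat_0_less_mult_iff zero_less_numeral)
  then show ?thesis
  proof
    assume *: "int (2 * m) dvd int (2 * j) - int (2 * j')"
    have "\<bar>int (2 * j) - int (2 * j')\<bar> < int (2 * m)" using j m by auto
    then have "int (2 * j) - int (2 * j') = 0" by (metis * dvd_imp_le_int abs_of_nat not_le)
    then show ?thesis using m by simp
  next
    \<comment> \<open>Both summands are positive and at most \<open>m\<close>, so this forces
      \<open>2 * j = 2 * j' = m\<close>.\<close>
    assume "int (2 * m) dvd int (2 * j) + int (2 * j')"
    then have "int (2 * m) \<le> int (2 * j) + int (2 * j')" using j by (intro zdvd_imp_le) auto
    then show ?thesis using j m by auto
  qed
qed

lemma num_gen_petersen_ge:
  fixes N :: nat
  defines "M \<equiv> N div 4"
  shows "real M * (real M / 2 - 9538) \<le> real (num_gen_petersen N)"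
proof -
  let ?X = "gen_petersen_upto N"
  let ?r = "{(X, Y). X \<in> ?X \<and> Y \<in> ?X \<and> multigraph_iso X Y}"
  \<comment> \<open>The cutoff \<open>M div 2\<close> does not depend on \<open>m\<close>: for
    \<open>m > M\<close> it gives \<open>2 * j \<le> M < m\<close>, so \<open>2 * j\<close> is
    admissible for \<open>n = 2 * m\<close>, while \<open>m \<le> 2 * M\<close> keeps
    \<open>n \<le> N\<close>.\<close>
  define J where "J m = {j \<in> {1..M div 2}. generic (2 * m) (2 * j)}" for m
  define D where "D = (SIGMA m:{M<..2 * M}. J m)"
  define \<psi> where "\<psi> = (\<lambda>(m, j). ?r `` {gen_petersen (2 * m) (2 * j)})"
  have finJ: "finite (J m)" for m by (simp add: J_def)
  have mem: "gen_petersen (2 * m) (2 * j) \<in> ?X" if "(m, j) \<in> D" for m j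
  proof -
    have "3 \<le> 2 * m" "2 * m \<le> N" "1 \<le> 2 * j" "2 * (2 * j) \<le> 2 * m"
      using that by (auto simp: D_def J_def M_def)
    then show ?thesis unfolding gen_petersen_upto_def by blast
  qed
  have eqv: "equiv ?X ?r" by (rule equiv_gen_petersen_iso[OF order_refl])
  have "inj_on \<psi> D"
  proof
    fix a b assume ab: "a \<in> D" "b \<in> D" "\<psi> a = \<psi> b"
    obtain m j m' j' where a: "a = (m, j)" and b: "b = (m', j')" by (cases a, cases b)
    have "multigraph_iso (gen_petersen (2 * m) (2 * j)) (gen_petersen (2 * m') (2 * j'))"
      using eq_equiv_class[OF _ eqv mem] ab by (auto simp: a b \<psi>_def)
    then have "m = m' \<and> j = j'"
      using ab by (intro gen_petersen_even_iso) (auto simp: a b D_def J_def)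
    then show "a = b" by (simp add: a b)
  qed
  moreover have "\<psi> (m, j) \<in> ?X // ?r" if "(m, j) \<in> D" for m j
    unfolding \<psi>_def prod.case by (rule quotientI[OF mem[OF that]])
  then have "\<psi> ` D \<subseteq> ?X // ?r" by force
  moreover have "finite (?X // ?r)"
    by (rule finite_quotient[OF finite_gen_petersen_upto]) auto
  ultimately have "card D \<le> num_gen_petersen N"
    unfolding num_gen_petersen_def num_iso_classes_def by (rule card_inj_on_le)
  moreover have "real M * (real M / 2 - 9538) \<le> real (card D)"
  proof -
    have J: "real M / 2 - 9538 \<le> real (card (J m))" if m: "m \<in> {M<..2 * M}" for m
    proof -
      let ?K = "{k. 1 \<le> k \<and> 2 * k \<le> 2 * m \<and> \<not> generic (2 * m) k}"
      have "{1..M div 2} - J m \<subseteq> (\<lambda>k. k div 2) ` ?K"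
      proof
        fix j assume "j \<in> {1..M div 2} - J m"
        then have "2 * j \<in> ?K" using m by (auto simp: J_def)
        then show "j \<in> (\<lambda>k. k div 2) ` ?K" by (intro image_eqI[of _ _ "2 * j"]) auto
      qed
      moreover have finK: "finite ?K" by (rule finite_subset[of _ "{..2 * m}"]) auto
      ultimately have "card ({1..M div 2} - J m) \<le> card ?K" by (intro surj_card_le) auto
      then have "card ({1..M div 2} - J m) \<le> 9537" using card_not_generic_le[of "2 * m"] by linarith
      moreover have "card ({1..M div 2} - J m) = M div 2 - card (J m)"
        by (subst card_Diff_subset) (auto simp: J_def)
      ultimately have "M div 2 \<le> 9537 + card (J m)" by linarith
      \<comment> \<open>Rounding in \<open>M div 2\<close> accounts for 9538 in place of
        9537.\<close>
      then show ?thesis by linarith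
    qed
    have "real M * (real M / 2 - 9538) = (\<Sum>m\<in>{M<..2 * M}. real M / 2 - 9538)" by simp
    also have "\<dots> \<le> (\<Sum>m\<in>{M<..2 * M}. real (card (J m)))" by (rule sum_mono) (rule J)
    also have "\<dots> = real (card D)" by (simp add: D_def finJ)
    finally show ?thesis .
  qed
  ultimately show ?thesis by linarith
qed

theorem theorem1p3:
  "(\<lambda>N. real (num_cayley_gen_petersen N) / real (num_gen_petersen N)) \<longlonglongrightarrow> 0"
proof -
  \<comment> \<open>An upper bound for the ratio in terms of \<open>M = N div 4\<close> alone, by
    \<open>N \<le> 4 * M + 3\<close>; it has order \<open>M^(3/2) / M^2\<close>.\<close>
  define h where "h M = (4 * real M + 3) * (9537 + 4 * sqrt (4 * real M + 3))
    / (real M * (real M / 2 - 9538))" for M :: nat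
  have "h \<longlonglongrightarrow> 0" unfolding h_def by real_asymp
  moreover have "filterlim (\<lambda>N::nat. N div 4) at_top at_top"
    unfolding filterlim_at_top
  proof
    fix Z :: nat
    show "\<forall>\<^sub>F N in at_top. Z \<le> N div 4"
      using eventually_ge_at_top[of "4 * Z"] by eventually_elim linarith
  qed
  ultimately have lim: "(\<lambda>N. h (N div 4)) \<longlonglongrightarrow> 0" by (rule filterlim_compose)
  have bound: "\<forall>\<^sub>F N in sequentially.
      real (num_cayley_gen_petersen N) / real (num_gen_petersen N) \<le> h (N div 4)"
    \<comment> \<open>This makes \<open>M \<ge> 25000\<close>, so that \<open>M / 2 - 9538\<close>
      is positive.\<close>
    using eventually_ge_at_top[of 100000]
  proof eventually_elim
    case (elim N)
    define M where "M = N div 4"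
    have "25000 \<le> M" "N \<le> 4 * M + 3" using elim by (auto simp: M_def)
    then have M: "real M \<ge> 25000" "real N \<le> 4 * real M + 3" by linarith+
    have "real (num_cayley_gen_petersen N) \<le> real N * (9537 + 4 * sqrt (real N))"
      by (rule num_cayley_gen_petersen_le)
    also have "\<dots> \<le> (4 * real M + 3) * (9537 + 4 * sqrt (4 * real M + 3))"
      using M by (intro mult_mono add_mono) auto
    finally have num: "real (num_cayley_gen_petersen N) \<le> (4 * real M + 3) * (9537 + 4 * sqrt (4 * real M + 3))" .
    have "real M * (real M / 2 - 9538) > 0" using M by simp
    then have "real (num_cayley_gen_petersen N) / real (num_gen_petersen N) \<le> h M"
      unfolding h_def using num_gen_petersen_ge[of N, folded M_def] num by (intro frac_le) auto
    then show ?case unfolding M_def .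
  qed
  show ?thesis
    by (rule tendsto_sandwich[OF _ bound tendsto_const lim]) simp
qed

end
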